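(* Let $X$ be a geodesic hyperbolic metric space, and $\varphi:X\to Y$ a quasi-isometry, where $Y$ is a metric space. Then $Y$ is hyperbolic if and only if it is quasiruled.
   Context: A metric space $(X,d)$ is hyperbolic if for some $\delta\ge0$, $(y|z)_w\ge\min\{(x|y)_w,(x|z)_w\}-\delta$ for all $w,x,y,z\in X$, where $(x|y)_w=\frac12(d(x,w)+d(y,w)-d(x,y))$ (no geodesicity is assumed). A map $f:X\to Y$ is a $(\lambda,c)$-quasi-isometric embedding ($\lambda\ge1$, $c\ge0$) if $\frac1\lambda d(x,x')-c\le d(f(x),f(x'))\le\lambda d(x,x')+c$ for all $x,x'$; it is a quasi-isometry if moreover $Y$ is contained in a bounded neighborhood of $f(X)$. A $(\lambda,c)$-quasigeodesic curve (resp. ray, segment) is given by a $(\lambda,c)$-quasi-isometric embedding of $\mathbb{R}$ (resp. $\mathbb{R}_+$, a compact interval). A space is $(\lambda,c)$-quasigeodesic if any pair of points can be joined by a $(\lambda,c)$-quasigeodesic segment. A $\tau$-quasiruler is a quasigeodesic $g$ (curve, ray or segment) such that $d(g(s),g(t))+d(g(t),g(u))-d(g(s),g(u))\le2\tau$ for all $s<t<u$ in its domain. A metric space is quasiruled if there are constants $(\lambda,c,\tau)$ such that the space is $(\lambda,c)$-quasigeodesic and every $(\lambda,c)$-quasigeodesic is a $\tau$-quasiruler. *)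

theory Defs
  imports "HOL-Analysis.Analysis"
begin

text \<open>
  Metric spaces are given as subsets of types of class \<^class>\<open>metric_space\<close>, with the
  induced distance; \<^term>\<open>UNIV\<close> gives the ambient space itself. Maps are total functions on
  the ambient type, and only their values on the stated domain matter.
\<close>

definition gromov_product :: "'a::metric_space \<Rightarrow> 'a \<Rightarrow> 'a \<Rightarrow> real" where
  "gromov_product w x y = (dist x w + dist y w - dist x y) / 2"

definition hyperbolic :: "'a::metric_space set \<Rightarrow> bool" where
  "hyperbolic X \<longleftrightarrow>
     (\<exists>\<delta>\<ge>0. \<forall>w\<in>X. \<forall>x\<in>X. \<forall>y\<in>X. \<forall>z\<in>X.
        gromov_product w y z \<ge> min (gromov_product w x y) (gromov_product w x z) - \<delta>)"

definition geodesic_space :: "'a::metric_space set \<Rightarrow> bool" where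
  "geodesic_space X \<longleftrightarrow>
     (\<forall>x\<in>X. \<forall>y\<in>X. \<exists>(a::real) b g. a \<le> b \<and> g ` {a..b} \<subseteq> X \<and> g a = x \<and> g b = y \<and>
        (\<forall>s\<in>{a..b}. \<forall>t\<in>{a..b}. dist (g s) (g t) = \<bar>s - t\<bar>))"

definition qi_embedding ::
  "real \<Rightarrow> real \<Rightarrow> 'a::metric_space set \<Rightarrow> 'b::metric_space set \<Rightarrow> ('a \<Rightarrow> 'b) \<Rightarrow> bool" where
  "qi_embedding L c X Y f \<longleftrightarrow>
     L \<ge> 1 \<and> c \<ge> 0 \<and> f ` X \<subseteq> Y \<and>
     (\<forall>x\<in>X. \<forall>x'\<in>X. 1 / L * dist x x' - c \<le> dist (f x) (f x') \<and>
                      dist (f x) (f x') \<le> L * dist x x' + c)"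

definition quasi_isometry ::
  "'a::metric_space set \<Rightarrow> 'b::metric_space set \<Rightarrow> ('a \<Rightarrow> 'b) \<Rightarrow> bool" where
  "quasi_isometry X Y f \<longleftrightarrow>
     (\<exists>L c. qi_embedding L c X Y f) \<and> (\<exists>r. Y \<subseteq> (\<Union>x\<in>X. cball (f x) r))"

text \<open>
  The three kinds of parameter domains: the line (curves), the half-line (rays) and the
  compact intervals (segments), including one-point intervals.
\<close>

definition quasigeodesic_domain :: "real set \<Rightarrow> bool" where
  "quasigeodesic_domain I \<longleftrightarrow> I = UNIV \<or> I = {0..} \<or> (\<exists>a b. a \<le> b \<and> I = {a..b})"

definition quasigeodesic ::
  "real \<Rightarrow> real \<Rightarrow> 'a::metric_space set \<Rightarrow> real set \<Rightarrow> (real \<Rightarrow> 'a) \<Rightarrow> bool" where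
  "quasigeodesic L c X I g \<longleftrightarrow> quasigeodesic_domain I \<and> qi_embedding L c I X g"

definition quasigeodesic_space :: "real \<Rightarrow> real \<Rightarrow> 'a::metric_space set \<Rightarrow> bool" where
  "quasigeodesic_space L c X \<longleftrightarrow>
     (\<forall>x\<in>X. \<forall>y\<in>X. \<exists>a b g. a \<le> b \<and> quasigeodesic L c X {a..b} g \<and> g a = x \<and> g b = y)"

definition quasiruler ::
  "real \<Rightarrow> 'a::metric_space set \<Rightarrow> real set \<Rightarrow> (real \<Rightarrow> 'a) \<Rightarrow> bool" where
  "quasiruler \<tau> X I g \<longleftrightarrow>
     (\<exists>L c. quasigeodesic L c X I g) \<and>
     (\<forall>s\<in>I. \<forall>t\<in>I. \<forall>u\<in>I. s < t \<and> t < u \<longrightarrow>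
        dist (g s) (g t) + dist (g t) (g u) - dist (g s) (g u) \<le> 2 * \<tau>)"

definition quasiruled :: "'a::metric_space set \<Rightarrow> bool" where
  "quasiruled X \<longleftrightarrow>
     (\<exists>L c \<tau>. L \<ge> 1 \<and> c \<ge> 0 \<and> quasigeodesic_space L c X \<and>
        (\<forall>I g. quasigeodesic L c X I g \<longrightarrow> quasiruler \<tau> X I g))"

end

theory Submission
  imports Defs
begin

text \<open>
  Write (x|y)_w for the Gromov product. The four-point condition alone controls quasigeodesics,
  although a hyperbolic space need not contain any geodesic. Fix base points x, y and give every
  point z two coordinates: the position (y|z)_x along an imaginary segment from x to y, and the
  height (x|y)_z above it. By the four-point inequality, any two points are at most as far
  apart as they would be in a tree with these coordinates, up to an additive constant
  (\<open>dist_le_via_projections\<close>), and two points whose heights add up to more than their distance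
  plus a constant have almost the same position (\<open>projection_contracts\<close>).

  The second fact is a contraction property: a path that stays high above x, y changes its position
  only by the hyperbolicity constant per step, however long the steps are chosen in advance, the
  height being adapted to them. With long steps such a path drifts more slowly than a quasigeodesic
  between its endpoints may, so a quasigeodesic from x to y has bounded height
  (\<open>quasigeodesic_gromov_product_bounded\<close>). Bounded height of every subsegment is precisely the
  quasiruler property. If Y is hyperbolic, this applies to its quasigeodesics, of which there are
  enough because images of geodesics of X join any two points of Y up to a bounded error.

  Conversely, let Y be quasiruled and let \<open>\<psi>\<close> from Y to X be a quasi-inverse. Although \<open>\<psi>\<close> distorts
  Gromov products, a bound on the product of the images of y, z at \<open>\<psi> p\<close> yields one on (y|z)_p
  (\<open>quasiruled_gromov_product_transfer\<close>): in X it means that \<open>\<psi> p\<close> is near the image of a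
  quasigeodesic from y to z, closeness is reflected by \<open>\<psi>\<close>, and in Y points near a quasiruler from
  y to z have bounded (y|z)_p. Now take w, y, z in Y. Some point q of a quasigeodesic from y to z is
  a centre of the triangle in X (\<open>quasigeodesic_contains_center\<close>), hence also in Y, and then (y|z)_w
  is d(w, q) up to a constant. For a fourth point x, hyperbolicity of X says that (x|y)_q or (x|z)_q
  is bounded in X, hence in Y, and this bounds (x|y)_w or (x|z)_w by d(w, q) plus a constant.
\<close>

section \<open>Distances between points seen from a pair of base points\<close>

definition delta_hyperbolic :: "real \<Rightarrow> 'a::metric_space set \<Rightarrow> bool" where
  "delta_hyperbolic \<delta> X \<longleftrightarrow> \<delta> \<ge> 0 \<and> (\<forall>w\<in>X. \<forall>x\<in>X. \<forall>y\<in>X. \<forall>z\<in>X.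
     gromov_product w y z \<ge> min (gromov_product w x y) (gromov_product w x z) - \<delta>)"

lemma hyperbolic_iff_delta_hyperbolic: "hyperbolic X \<longleftrightarrow> (\<exists>\<delta>. delta_hyperbolic \<delta> X)"
  unfolding hyperbolic_def delta_hyperbolic_def by blast

lemma delta_hyperbolic_nonneg: "delta_hyperbolic \<delta> X \<Longrightarrow> 0 \<le> \<delta>"
  by (simp add: delta_hyperbolic_def)

lemma gromov_product_endpoint [simp]:
  "gromov_product x x y = 0" "gromov_product y x y = 0"
  by (simp_all add: gromov_product_def dist_commute)

lemma gromov_product_change_base:
  "gromov_product p x y \<le> gromov_product q x y + dist p q"
  using dist_triangle[of x p q] dist_triangle[of y p q]
  by (simp add: gromov_product_def dist_commute field_simps)

lemma gromov_product_change_point: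
  "\<bar>gromov_product x y p - gromov_product x y q\<bar> \<le> dist p q"
  using dist_triangle[of x p q] dist_triangle[of x q p]
    dist_triangle[of y p q] dist_triangle[of y q p]
  by (simp add: gromov_product_def dist_commute field_simps abs_le_iff)

text \<open>
  These two identities make (y|z)_x and (x|y)_z coordinates of z: the position of its branching
  point on the segment from x to y, and the length of the branch, in the tree spanned by x, y, z.
\<close>

lemma dist_eq_projection_plus_height:
  "dist x z = gromov_product x y z + gromov_product z x y"
  "dist y z = dist x y - gromov_product x y z + gromov_product z x y"
  by (simp_all add: gromov_product_def dist_commute field_simps)

text \<open>
  Clearing the base point from the definition: of the three ways to split four points into pairs,
  the two largest sums of distances differ by at most twice the hyperbolicity constant.
\<close>

lemma four_point_inequality:
  assumes "delta_hyperbolic \<delta> X" "a \<in> X" "b \<in> X" "c \<in> X" "d \<in> X"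
  shows "dist a b + dist c d \<le> max (dist a c + dist b d) (dist a d + dist b c) + 2 * \<delta>"
proof -
  have "gromov_product d a b \<ge> min (gromov_product d c a) (gromov_product d c b) - \<delta>"
    using assms unfolding delta_hyperbolic_def by blast
  then show ?thesis
    by (auto simp: gromov_product_def min_def max_def dist_commute field_simps split: if_splits)
qed

text \<open>
  The right-hand side is the distance in a tree that consists of a segment from x to y with branches
  attached to it. Only an upper bound holds in general, since p and q may lie on a common branch.
\<close>

lemma dist_le_via_projections:
  assumes "delta_hyperbolic \<delta> X" "x \<in> X" "y \<in> X" "p \<in> X" "q \<in> X"
  shows "dist p q \<le> gromov_product p x y + gromov_product q x y
    + \<bar>gromov_product x y p - gromov_product x y q\<bar> + 2 * \<delta>"
  using four_point_inequality[OF assms]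
    dist_eq_projection_plus_height[where x = x and y = y and z = p]
    dist_eq_projection_plus_height[where x = x and y = y and z = q]
  by (simp add: max_def abs_if split: if_splits)

text \<open>
  If the positions of p and q differed by more than \<open>\<delta>\<close>, the four-point inequality would
  separate p and q by at least the sum of their heights minus \<open>2 * \<delta>\<close>, as in a tree, where the way
  from p to q leads down to the segment and up again.
\<close>

lemma projection_contracts:
  assumes "delta_hyperbolic \<delta> X" "x \<in> X" "y \<in> X" "p \<in> X" "q \<in> X"
    and "dist p q + 2 * \<delta> < gromov_product p x y + gromov_product q x y"
  shows "\<bar>gromov_product x y p - gromov_product x y q\<bar> \<le> \<delta>"
proof -
  define hp hq where "hp = gromov_product p x y" and "hq = gromov_product q x y"
  define pp pq where "pp = gromov_product x y p" and "pq = gromov_product x y q"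
  have eqs: "dist x p = pp + hp" "dist x q = pq + hq"
    "dist y p = dist x y - pp + hp" "dist y q = dist x y - pq + hq"
    unfolding hp_def hq_def pp_def pq_def by (rule dist_eq_projection_plus_height)+
  have far: "dist p q + 2 * \<delta> < hp + hq" using assms(6) by (simp add: hp_def hq_def)
  have "dist x p + dist y q \<le> max (dist x y + dist p q) (dist x q + dist y p) + 2 * \<delta>"
    "dist x q + dist y p \<le> max (dist x y + dist p q) (dist x p + dist y q) + 2 * \<delta>"
    using four_point_inequality[OF assms(1,2,4,3,5)] four_point_inequality[OF assms(1,2,5,3,4)]
    by (simp_all add: dist_commute)
  then have "\<bar>pp - pq\<bar> \<le> \<delta>"
    unfolding eqs using far delta_hyperbolic_nonneg[OF assms(1)] by linarith
  then show ?thesis by (simp add: pp_def pq_def)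
qed

section \<open>Quasi-isometric embeddings\<close>

lemma qi_embedding_lower:
  assumes "qi_embedding L c X Y f" "x \<in> X" "x' \<in> X"
  shows "dist x x' \<le> L * (dist (f x) (f x') + c)"
proof -
  have "1 / L * dist x x' - c \<le> dist (f x) (f x')" "L \<ge> 1"
    using assms by (auto simp: qi_embedding_def)
  then show ?thesis by (simp add: field_simps)
qed

lemma qi_embeddingI:
  assumes "L \<ge> 1" "c \<ge> 0" "\<And>x. x \<in> X \<Longrightarrow> f x \<in> Y"
    and "\<And>x x'. x \<in> X \<Longrightarrow> x' \<in> X \<Longrightarrow> dist x x' \<le> L * (dist (f x) (f x') + c)"
    and "\<And>x x'. x \<in> X \<Longrightarrow> x' \<in> X \<Longrightarrow> dist (f x) (f x') \<le> L * dist x x' + c"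
  shows "qi_embedding L c X Y f"
proof -
  have "1 / L * dist x x' - c \<le> dist (f x) (f x')" if "x \<in> X" "x' \<in> X" for x x'
    using assms(4)[OF that] assms(1) by (simp add: field_simps)
  then show ?thesis using assms by (auto simp: qi_embedding_def)
qed

lemma qi_embedding_compose:
  assumes f: "qi_embedding L c X Y f" and g: "qi_embedding L' c' Y Z g"
  shows "qi_embedding (L * L') (L' * c + c') X Z (\<lambda>x. g (f x))"
proof -
  have L: "L \<ge> 1" "c \<ge> 0" "L' \<ge> 1" "c' \<ge> 0"
    using f g by (auto simp: qi_embedding_def)
  have fY: "f x \<in> Y" if "x \<in> X" for x using f that by (auto simp: qi_embedding_def)
  show ?thesis
  proof (rule qi_embeddingI)
    show "L * L' \<ge> 1" using mult_mono[of 1 L 1 L'] L by simp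
    show "0 \<le> L' * c + c'" using L by simp
    show "g (f x) \<in> Z" if "x \<in> X" for x
      using g fY[OF that] by (auto simp: qi_embedding_def)
    fix x x' assume x: "x \<in> X" "x' \<in> X"
    have "dist x x' \<le> L * (dist (f x) (f x') + c)" by (rule qi_embedding_lower[OF f x])
    also have "\<dots> \<le> L * (L' * (dist (g (f x)) (g (f x')) + c') + c)"
      using qi_embedding_lower[OF g fY[OF x(1)] fY[OF x(2)]] L by (simp add: mult_left_mono)
    also have "\<dots> = L * L' * (dist (g (f x)) (g (f x')) + c') + L * (1 * c)"
      by (simp add: algebra_simps)
    also have "\<dots> \<le> L * L' * (dist (g (f x)) (g (f x')) + c') + L * (L' * (L' * c))"
    proof -
      have "1 * c \<le> L' * (L' * c)"
        using L by (intro mult_mono) (auto intro: order_trans[of _ "1 * c"] mult_right_mono)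
      then show ?thesis using L by (intro add_left_mono mult_left_mono) auto
    qed
    finally show "dist x x' \<le> L * L' * (dist (g (f x)) (g (f x')) + (L' * c + c'))"
      by (simp add: algebra_simps)
    have "dist (g (f x)) (g (f x')) \<le> L' * dist (f x) (f x') + c'"
      using g fY[OF x(1)] fY[OF x(2)] by (auto simp: qi_embedding_def)
    also have "\<dots> \<le> L' * (L * dist x x' + c) + c'"
      using f x L by (intro add_right_mono mult_left_mono) (auto simp: qi_embedding_def)
    finally show "dist (g (f x)) (g (f x')) \<le> L * L' * dist x x' + (L' * c + c')"
      by (simp add: algebra_simps)
  qed
qed

lemma qi_embedding_perturb:
  assumes f: "qi_embedding L c X Y f" and "r \<ge> 0"
    and g: "\<And>x. x \<in> X \<Longrightarrow> g x \<in> Y \<and> dist (f x) (g x) \<le> r"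
  shows "qi_embedding L (c + 2 * r) X Y g"
proof (rule qi_embeddingI)
  show L: "L \<ge> 1" "c + 2 * r \<ge> 0" using f assms(2) by (auto simp: qi_embedding_def)
  show "g x \<in> Y" if "x \<in> X" for x using g[OF that] by simp
  fix x x' assume x: "x \<in> X" "x' \<in> X"
  have close: "dist (f x) (f x') \<le> dist (g x) (g x') + 2 * r"
      "dist (g x) (g x') \<le> dist (f x) (f x') + 2 * r"
    using g[OF x(1)] g[OF x(2)] by metric+
  have "dist x x' \<le> L * (dist (f x) (f x') + c)" by (rule qi_embedding_lower[OF f x])
  also have "\<dots> \<le> L * (dist (g x) (g x') + (c + 2 * r))"
    using close L by (intro mult_left_mono) auto
  finally show "dist x x' \<le> L * (dist (g x) (g x') + (c + 2 * r))" .
  have "dist (f x) (f x') \<le> L * dist x x' + c"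
    using f x by (auto simp: qi_embedding_def)
  then show "dist (g x) (g x') \<le> L * dist x x' + (c + 2 * r)" using close by linarith
qed

lemma qi_embedding_subset:
  "qi_embedding L c X Y f \<Longrightarrow> X' \<subseteq> X \<Longrightarrow> qi_embedding L c X' Y f"
  unfolding qi_embedding_def by blast

lemma quasi_isometry_quasi_inverse:
  assumes "quasi_isometry X Y \<phi>"
  obtains \<psi> L c r where "qi_embedding L c Y X \<psi>" "r \<ge> 0"
    "\<And>y. y \<in> Y \<Longrightarrow> dist (\<phi> (\<psi> y)) y \<le> r"
proof -
  obtain L c r0 where \<phi>: "qi_embedding L c X Y \<phi>" and r0: "Y \<subseteq> (\<Union>x\<in>X. cball (\<phi> x) r0)"
    using assms by (auto simp: quasi_isometry_def)
  define r where "r = max r0 0"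
  have "\<exists>x\<in>X. dist (\<phi> x) y \<le> r" if y: "y \<in> Y" for y
  proof -
    obtain x where "x \<in> X" "dist (\<phi> x) y \<le> r0" using r0 y by auto
    then show ?thesis by (intro bexI[of _ x]) (auto simp: r_def)
  qed
  then obtain \<psi> where \<psi>: "\<And>y. y \<in> Y \<Longrightarrow> \<psi> y \<in> X" "\<And>y. y \<in> Y \<Longrightarrow> dist (\<phi> (\<psi> y)) y \<le> r"
    by metis
  have L: "L \<ge> 1" "c \<ge> 0" "r \<ge> 0" using \<phi> by (auto simp: qi_embedding_def r_def)
  have "qi_embedding L (L * (2 * r + c)) Y X \<psi>"
  proof (rule qi_embeddingI)
    fix y y' assume y: "y \<in> Y" "y' \<in> Y"
    have close: "dist (\<phi> (\<psi> y)) (\<phi> (\<psi> y')) \<le> dist y y' + 2 * r"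
        "dist y y' \<le> dist (\<phi> (\<psi> y)) (\<phi> (\<psi> y')) + 2 * r"
      using \<psi>(2)[OF y(1)] \<psi>(2)[OF y(2)] by metric+
    have "dist (\<psi> y) (\<psi> y') \<le> L * (dist (\<phi> (\<psi> y)) (\<phi> (\<psi> y')) + c)"
      using qi_embedding_lower[OF \<phi>] \<psi>(1) y by blast
    also have "\<dots> \<le> L * (dist y y' + 2 * r + c)"
      using close L by (intro mult_left_mono) auto
    finally show "dist (\<psi> y) (\<psi> y') \<le> L * dist y y' + L * (2 * r + c)"
      by (simp add: algebra_simps)
    have "dist (\<phi> (\<psi> y)) (\<phi> (\<psi> y')) \<le> L * dist (\<psi> y) (\<psi> y') + c"
      using \<phi> \<psi>(1) y by (auto simp: qi_embedding_def)
    moreover have "2 * r + c \<le> L * (L * (2 * r + c))"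
    proof -
      have "1 * (2 * r + c) \<le> (L * L) * (2 * r + c)"
        using L mult_mono[of 1 L 1 L] by (intro mult_right_mono) auto
      then show ?thesis by (simp add: mult.assoc)
    qed
    ultimately show "dist y y' \<le> L * (dist (\<psi> y) (\<psi> y') + L * (2 * r + c))"
      using close by (simp add: distrib_left)
  qed (use L \<psi> in auto)
  then show ?thesis using that \<psi>(2) L(3) by blast
qed

text \<open>
  To join y and y', map a geodesic between their quasi-inverse images back to Y, and correct the two
  ends, which miss y and y' by a bounded distance.
\<close>

lemma quasi_isometric_to_geodesic_imp_quasigeodesic_space:
  assumes geo: "geodesic_space X" and qi: "quasi_isometry X Y \<phi>"
  obtains L c where "L \<ge> 1" "c \<ge> 0" "quasigeodesic_space L c Y"
proof -
  obtain L c where \<phi>: "qi_embedding L c X Y \<phi>" using qi by (auto simp: quasi_isometry_def)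
  obtain \<psi> L' c' r where \<psi>: "qi_embedding L' c' Y X \<psi>" and r: "r \<ge> 0"
    and close: "\<And>y. y \<in> Y \<Longrightarrow> dist (\<phi> (\<psi> y)) y \<le> r"
    using quasi_isometry_quasi_inverse[OF qi] by metis
  define C where "C = L * 1 + c + 2 * r"
  have L: "L \<ge> 1" "c \<ge> 0" using \<phi> by (auto simp: qi_embedding_def)
  have "quasigeodesic_space L C Y"
    unfolding quasigeodesic_space_def
  proof (intro ballI)
    fix y y' assume y: "y \<in> Y" "y' \<in> Y"
    then have "\<psi> y \<in> X" "\<psi> y' \<in> X" using \<psi> by (auto simp: qi_embedding_def)
    then obtain a b :: real and g where ab: "a \<le> b" and g: "g ` {a..b} \<subseteq> X"
      "g a = \<psi> y" "g b = \<psi> y'"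
      "\<forall>s\<in>{a..b}. \<forall>t\<in>{a..b}. dist (g s) (g t) = \<bar>s - t\<bar>"
      using geo unfolding geodesic_space_def by metis
    (* Parametrising over an interval longer by 1 keeps the two end parameters distinct, so that
       they can be sent to y and y' even if the quasi-inverse identifies these points. *)
    have "qi_embedding 1 1 {a..b + 1} {a..b} (\<lambda>t. min t b)"
      using ab by (intro qi_embeddingI) (auto simp: dist_real_def min_def)
    moreover have "qi_embedding 1 0 {a..b} X g"
      using g by (intro qi_embeddingI) (auto simp: dist_real_def)
    ultimately have "qi_embedding (1 * 1) (1 * 1 + 0) {a..b + 1} X (\<lambda>t. g (min t b))"
      by (rule qi_embedding_compose)
    then have "qi_embedding (1 * 1 * L) (L * (1 * 1 + 0) + c) {a..b + 1} Y (\<lambda>t. \<phi> (g (min t b)))"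
      by (rule qi_embedding_compose[OF _ \<phi>])
    then have h: "qi_embedding L (L * 1 + c) {a..b + 1} Y (\<lambda>t. \<phi> (g (min t b)))" by simp
    define k where "k t = (if t = a then y else if t = b + 1 then y' else \<phi> (g (min t b)))" for t
    have "k t \<in> Y \<and> dist (\<phi> (g (min t b))) (k t) \<le> r" if "t \<in> {a..b + 1}" for t
    proof -
      have "\<phi> (g (min t b)) \<in> Y" using h that by (auto simp: qi_embedding_def)
      moreover have "dist (\<phi> (g (min t b))) y \<le> r" if "t = a"
        using that ab g(2) close[OF y(1)] by simp
      moreover have "dist (\<phi> (g (min t b))) y' \<le> r" if "t = b + 1"
        using that g(3) close[OF y(2)] by simp
      ultimately show ?thesis using y r by (simp add: k_def)
    qed
    then have "qi_embedding L C {a..b + 1} Y k"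
      unfolding C_def by (rule qi_embedding_perturb[OF h r])
    then have "quasigeodesic L C Y {a..b + 1} k"
      using ab by (auto simp: quasigeodesic_def quasigeodesic_domain_def)
    moreover have "k a = y" "k (b + 1) = y'" using ab by (auto simp: k_def)
    ultimately show "\<exists>a b g. a \<le> b \<and> quasigeodesic L C Y {a..b} g \<and> g a = y \<and> g b = y'"
      using ab by (intro exI[of _ a] exI[of _ "b + 1"] exI[of _ k]) auto
  qed
  moreover have "C \<ge> 0" using L r by (simp add: C_def)
  ultimately show ?thesis using that L by blast
qed

section \<open>Quasigeodesics in hyperbolic spaces\<close>

text \<open>
  The walk stops one step before its height first drops to H. Until then every step takes place at
  heights whose sum exceeds the step size by more than \<open>2 * \<delta>\<close>, so each contributes
  at most \<open>\<delta>\<close> to the position.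
  The alternative m = 0 covers a walk that starts at height at most H.
\<close>

lemma walk_down_to_height:
  fixes z :: "nat \<Rightarrow> 'a::metric_space"
  assumes hyp: "delta_hyperbolic \<delta> X" and xy: "x \<in> X" "y \<in> X"
    and z: "\<And>i. z i \<in> X" "\<And>i. dist (z i) (z (Suc i)) \<le> B"
    and H: "H \<ge> B + \<delta>" "B \<ge> 0"
    and N: "gromov_product (z N) x y \<le> H"
  obtains m where "gromov_product (z m) x y \<le> H + B"
    "\<bar>gromov_product x y (z m) - gromov_product x y (z 0)\<bar> \<le> m * \<delta>"
    "m = 0 \<or> gromov_product (z m) x y > H"
proof -
  define n where "n = (LEAST n. gromov_product (z n) x y \<le> H)"
  have n: "gromov_product (z n) x y \<le> H" unfolding n_def using N by (rule LeastI)
  have before: "gromov_product (z i) x y > H" if "i < n" for i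
    using not_less_Least that unfolding n_def by fastforce
  have proj: "\<bar>gromov_product x y (z i) - gromov_product x y (z 0)\<bar> \<le> i * \<delta>" if "i < n" for i
    using that
  proof (induction i)
    case (Suc i)
    have "\<bar>gromov_product x y (z i) - gromov_product x y (z (Suc i))\<bar> \<le> \<delta>"
      using before[of i] before[of "Suc i"] Suc.prems z(2)[of i] H
      by (intro projection_contracts[OF hyp xy z(1) z(1)]) linarith
    then show ?case using Suc by (simp add: algebra_simps)
  qed simp
  show ?thesis
  proof (cases n)
    case 0
    then show ?thesis using that[of 0] n H by simp
  next
    case (Suc m)
    have "gromov_product (z m) x y \<le> H + B"
      using gromov_product_change_base[of "z m" x y "z (Suc m)"] n z(2)[of m] Suc by simp
    then show ?thesis using that[of m] proj[of m] before[of m] Suc by simp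
  qed
qed

text \<open>
  Coarse Morse lemma without geodesics. From g t, walk along g in both directions by parameter
  steps l until the height has come down. The two stopping points v and w have bounded height, so
  their distance is at most a constant plus their difference of positions, which is at most
  \<open>\<delta> * (w - v) / l\<close>. As g is a quasigeodesic, that distance is also at least \<open>(w - v) / L - c\<close>.
  For l large compared with \<open>L * \<delta>\<close> the two bounds are compatible only if w - v is bounded; then
  g t is close to g v and inherits a bound on its height.
\<close>

theorem quasigeodesic_gromov_product_bounded:
  fixes X :: "'a::metric_space set"
  assumes hyp: "delta_hyperbolic \<delta> X" and L: "L \<ge> 1" "c \<ge> 0"
  obtains M where "M \<ge> 0" "\<And>(g :: real \<Rightarrow> 'a) s t u. qi_embedding L c {s..u} X g \<Longrightarrow> s \<le> t \<Longrightarrow> t \<le> u \<Longrightarrow>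
    gromov_product (g t) (g s) (g u) \<le> M"
proof -
  (* The step l makes the drift per unit of parameter at most 1 / (2 L), half of the minimal speed
     1 / L of g. A step moves by at most B, and H is a height above which such steps contract.
     The summand 1 keeps l positive when \<delta> = 0. *)
  define l where "l = 2 * L * \<delta> + 1"
  define B where "B = L * l + c"
  define H where "H = B + \<delta>"
  define T where "T = 2 * L * (2 * (H + B) + 2 * \<delta> + c)"
  define M where "M = H + B + L * T + c"
  have \<delta>: "\<delta> \<ge> 0" using hyp by (rule delta_hyperbolic_nonneg)
  have l: "l > 0" using \<delta> L by (simp add: l_def add_nonneg_pos)
  have B: "B \<ge> 0" using l L by (simp add: B_def)
  have H: "H \<ge> 0" using B \<delta> by (simp add: H_def)
  have T: "T \<ge> 0" using H B \<delta> L by (simp add: T_def)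
  have M: "M \<ge> 0" using H B T L by (simp add: M_def)
  have "gromov_product (g t) (g s) (g u) \<le> M"
    if g: "qi_embedding L c {s..u} X g" and st: "s \<le> t" "t \<le> u"
    for g :: "real \<Rightarrow> 'a" and s t u
  proof -
    define height where "height r = gromov_product (g r) (g s) (g u)" for r
    define proj where "proj r = gromov_product (g s) (g u) (g r)" for r
    have gX: "g r \<in> X" if "r \<in> {s..u}" for r using g that by (auto simp: qi_embedding_def)
    have gu: "dist (g r) (g r') \<le> L * \<bar>r - r'\<bar> + c" if "r \<in> {s..u}" "r' \<in> {s..u}" for r r'
      using g that by (auto simp: qi_embedding_def dist_real_def)
    have xy: "g s \<in> X" "g u \<in> X" using gX st by auto
    have step: "dist (g r) (g r') \<le> B" if "r \<in> {s..u}" "r' \<in> {s..u}" "\<bar>r - r'\<bar> \<le> l" for r r'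
    proof -
      have "L * \<bar>r - r'\<bar> \<le> L * l" using that(3) L by (intro mult_left_mono) auto
      then show ?thesis using gu[OF that(1,2)] by (simp add: B_def)
    qed
    obtain v where v: "s \<le> v" "v \<le> t" "height v \<le> H + B" "\<bar>proj v - proj t\<bar> \<le> \<delta> * (t - v) / l"
    proof -
      define r where "r i = max s (t - real i * l)" for i :: nat
      have r: "r i \<in> {s..u}" for i
        using st l by (auto simp: r_def intro: order_trans[of _ t])
      obtain N :: nat where "(t - s) / l \<le> real N" using real_arch_simple by blast
      then have "r N = s" using l by (simp add: r_def field_simps)
      then have N: "gromov_product (g (r N)) (g s) (g u) \<le> H" using H by simp
      have "dist (g (r i)) (g (r (Suc i))) \<le> B" for i
        using l by (intro step r) (auto simp: r_def algebra_simps)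
      then obtain m where m: "height (r m) \<le> H + B" "\<bar>proj (r m) - proj (r 0)\<bar> \<le> m * \<delta>"
        "m = 0 \<or> height (r m) > H"
        using walk_down_to_height[where z = "\<lambda>i. g (r i)", OF hyp xy gX[OF r] _ _ B N]
        unfolding height_def proj_def H_def by blast
      have "r m = t - m * l"
      proof (cases "m = 0")
        case False
        then have "r m \<noteq> s" using m(3) H by (auto simp: height_def)
        then show ?thesis by (auto simp: r_def max_def split: if_splits)
      qed (use st in \<open>simp add: r_def\<close>)
      moreover have "r 0 = t" using st by (simp add: r_def)
      ultimately show ?thesis using that[of "r m"] m r[of m] l by (auto simp: mult.commute)
    qed
    (* the mirror image of the previous walk, towards the other end of the interval *)
    obtain w where w: "t \<le> w" "w \<le> u" "height w \<le> H + B" "\<bar>proj w - proj t\<bar> \<le> \<delta> * (w - t) / l"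
    proof -
      define r where "r i = min u (t + real i * l)" for i :: nat
      have r: "r i \<in> {s..u}" for i
        using st l by (auto simp: r_def intro: order_trans[of _ t])
      obtain N :: nat where "(u - t) / l \<le> real N" using real_arch_simple by blast
      then have "r N = u" using l by (simp add: r_def field_simps)
      then have N: "gromov_product (g (r N)) (g s) (g u) \<le> H" using H by simp
      have "dist (g (r i)) (g (r (Suc i))) \<le> B" for i
        using l by (intro step r) (auto simp: r_def algebra_simps)
      then obtain m where m: "height (r m) \<le> H + B" "\<bar>proj (r m) - proj (r 0)\<bar> \<le> m * \<delta>"
        "m = 0 \<or> height (r m) > H"
        using walk_down_to_height[where z = "\<lambda>i. g (r i)", OF hyp xy gX[OF r] _ _ B N]
        unfolding height_def proj_def H_def by blast
      have "r m = t + m * l"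
      proof (cases "m = 0")
        case False
        then have "r m \<noteq> u" using m(3) H by (auto simp: height_def)
        then show ?thesis by (auto simp: r_def min_def split: if_splits)
      qed (use st in \<open>simp add: r_def\<close>)
      moreover have "r 0 = t" using st by (simp add: r_def)
      ultimately show ?thesis using that[of "r m"] m r[of m] l by (auto simp: mult.commute)
    qed
    have slope: "\<delta> * (w - v) / l \<le> (w - v) / (2 * L)"
    proof -
      have "2 * L * \<delta> * (w - v) \<le> l * (w - v)"
        using v w by (intro mult_right_mono) (auto simp: l_def)
      then show ?thesis using l L by (simp add: field_simps)
    qed
    define e where "e = (w - v) / (2 * L)"
    have "\<bar>proj v - proj w\<bar> \<le> \<delta> * (t - v) / l + \<delta> * (w - t) / l"
      using v(4) w(4) by linarith
    also have "\<dots> = \<delta> * (w - v) / l"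
      by (simp add: add_divide_distrib[symmetric] distrib_left[symmetric])
    also have "\<dots> \<le> e" unfolding e_def by (rule slope)
    finally have e: "\<bar>proj v - proj w\<bar> \<le> e" .
    have "dist (g v) (g w) \<le> height v + height w + \<bar>proj v - proj w\<bar> + 2 * \<delta>"
      unfolding height_def proj_def using v w
      by (intro dist_le_via_projections[OF hyp xy] gX) auto
    then have "dist (g v) (g w) + c \<le> 2 * (H + B) + e + 2 * \<delta> + c"
      using v(3) w(3) e by simp
    then have "L * (dist (g v) (g w) + c) \<le> L * (2 * (H + B) + e + 2 * \<delta> + c)"
      using L by (intro mult_left_mono) auto
    moreover have "w - v \<le> L * (dist (g v) (g w) + c)"
      using qi_embedding_lower[OF g, of v w] v w by (simp add: dist_real_def)
    ultimately have "w - v \<le> L * (2 * (H + B) + e + 2 * \<delta> + c)"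
      by linarith
    also have "\<dots> = T / 2 + (w - v) / 2" using L by (simp add: T_def e_def field_simps)
    finally have "w - v \<le> T" by (simp add: field_simps)
    then have "L * \<bar>t - v\<bar> \<le> L * T" using v w L by (intro mult_left_mono) auto
    then have "dist (g t) (g v) \<le> L * T + c" using gu[of t v] v st by simp
    then show ?thesis
      using gromov_product_change_base[of "g t" "g s" "g u" "g v"] v(3)
      by (simp add: height_def M_def)
  qed
  then show ?thesis using that M by blast
qed

theorem hyperbolic_quasigeodesic_is_quasiruler:
  fixes X :: "'a::metric_space set"
  assumes "hyperbolic X" "L \<ge> 1" "c \<ge> 0"
  obtains \<tau> where "\<And>I g. quasigeodesic L c X I g \<Longrightarrow> quasiruler \<tau> X I g"
proof -
  obtain \<delta> where "delta_hyperbolic \<delta> X" using assms by (auto simp: hyperbolic_iff_delta_hyperbolic)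
  then obtain M where M: "\<And>(g :: real \<Rightarrow> 'a) s t u. qi_embedding L c {s..u} X g \<Longrightarrow> s \<le> t \<Longrightarrow> t \<le> u \<Longrightarrow>
      gromov_product (g t) (g s) (g u) \<le> M"
    using quasigeodesic_gromov_product_bounded assms(2,3) by metis
  have "quasiruler M X I g" if g: "quasigeodesic L c X I g" for I g
  proof -
    have "dist (g s) (g t) + dist (g t) (g u) - dist (g s) (g u) \<le> 2 * M"
      if "s \<in> I" "u \<in> I" "s < t" "t < u" for s t u
    proof -
      have "{s..u} \<subseteq> I" using g that by (auto simp: quasigeodesic_def quasigeodesic_domain_def)
      then have "qi_embedding L c {s..u} X g"
        using g by (auto simp: quasigeodesic_def intro: qi_embedding_subset)
      from M[OF this] that have "gromov_product (g t) (g s) (g u) \<le> M" by simp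
      then show ?thesis by (simp add: gromov_product_def dist_commute)
    qed
    then show ?thesis using g by (auto simp: quasiruler_def)
  qed
  then show ?thesis by (rule that)
qed

text \<open>
  Quasigeodesics need not be continuous, so the intermediate value theorem is replaced by walking
  in unit steps and stopping at the first value that is at least v.
\<close>

lemma coarse_intermediate_value:
  fixes F :: "real \<Rightarrow> real"
  assumes step: "\<And>s t. s \<in> {a..b} \<Longrightarrow> t \<in> {a..b} \<Longrightarrow> \<bar>s - t\<bar> \<le> 1 \<Longrightarrow> \<bar>F s - F t\<bar> \<le> B"
    and "a \<le> b" "F a \<le> v" "v \<le> F b"
  obtains t where "t \<in> {a..b}" "\<bar>F t - v\<bar> \<le> B"
proof -
  define r where "r i = min b (a + real i)" for i :: nat
  have r: "r i \<in> {a..b}" for i using assms(2) by (auto simp: r_def)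
  obtain N :: nat where "b - a \<le> real N" using real_arch_simple by blast
  then have "r N = b" by (simp add: r_def)
  then have N: "v \<le> F (r N)" using assms(4) by simp
  define n where "n = (LEAST n. v \<le> F (r n))"
  have n: "v \<le> F (r n)" unfolding n_def using N by (rule LeastI)
  show ?thesis
  proof (cases n)
    case 0
    then have "F a = v" using n assms(2,3) by (simp add: r_def)
    moreover have "B \<ge> 0" using step[of a a] assms(2) by simp
    ultimately show ?thesis using that[of a] assms(2) by simp
  next
    case (Suc m)
    then have "m < n" by simp
    then have "F (r m) < v" unfolding n_def using not_less_Least by fastforce
    moreover have "\<bar>F (r m) - F (r n)\<bar> \<le> B" using r Suc by (intro step) (auto simp: r_def)
    ultimately show ?thesis using that[of "r n"] r n by (simp add: abs_le_iff)
  qed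
qed

lemma quasigeodesic_hits_projection:
  fixes g :: "real \<Rightarrow> 'a::metric_space"
  assumes g: "qi_embedding L c {a..b} X g" and "a \<le> b"
  obtains t where "t \<in> {a..b}"
    "\<bar>gromov_product (g a) (g b) (g t) - gromov_product (g a) (g b) p\<bar> \<le> L + c"
proof -
  define F where "F t = gromov_product (g a) (g b) (g t)" for t
  have "\<bar>F s - F t\<bar> \<le> L + c" if "s \<in> {a..b}" "t \<in> {a..b}" "\<bar>s - t\<bar> \<le> 1" for s t
  proof -
    have "dist (g s) (g t) \<le> L * \<bar>s - t\<bar> + c" "L \<ge> 1"
      using g that by (auto simp: qi_embedding_def dist_real_def)
    moreover from this have "L * \<bar>s - t\<bar> \<le> L * 1" using that(3) by (intro mult_left_mono) auto
    ultimately show ?thesis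
      using gromov_product_change_point[of "g a" "g b" "g s" "g t"] unfolding F_def by linarith
  qed
  note step = this
  have bounds: "F a \<le> gromov_product (g a) (g b) p" "gromov_product (g a) (g b) p \<le> F b"
    using dist_triangle[of "g a" "g b" p] dist_triangle[of "g b" p "g a"]
      dist_triangle[of "g a" p "g b"]
    by (simp_all add: F_def gromov_product_def dist_commute field_simps)
  obtain t where "t \<in> {a..b}" "\<bar>F t - gromov_product (g a) (g b) p\<bar> \<le> L + c"
    using coarse_intermediate_value[OF step assms(2) bounds] by blast
  then show ?thesis using that[of t] by (simp add: F_def)
qed

text \<open>
  The point of g at the position of p has bounded height, so the tree-like upper bound for its
  distance from p reduces to the height of p plus a constant.
\<close>

lemma quasigeodesic_passes_near:
  fixes X :: "'a::metric_space set"
  assumes hyp: "delta_hyperbolic \<delta> X" and L: "L \<ge> 1" "c \<ge> 0"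
  obtains K where "\<And>(g :: real \<Rightarrow> 'a) a b p. qi_embedding L c {a..b} X g \<Longrightarrow> a \<le> b \<Longrightarrow> p \<in> X \<Longrightarrow>
    \<exists>t\<in>{a..b}. dist p (g t) \<le> gromov_product p (g a) (g b) + K"
proof -
  obtain M where M: "\<And>(g :: real \<Rightarrow> 'a) s t u. qi_embedding L c {s..u} X g \<Longrightarrow> s \<le> t \<Longrightarrow> t \<le> u \<Longrightarrow>
      gromov_product (g t) (g s) (g u) \<le> M"
    using quasigeodesic_gromov_product_bounded[OF hyp L] by metis
  have "\<exists>t\<in>{a..b}. dist p (g t) \<le> gromov_product p (g a) (g b) + (M + (L + c) + 2 * \<delta>)"
    if g: "qi_embedding L c {a..b} X g" "a \<le> b" "p \<in> X" for g :: "real \<Rightarrow> 'a" and a b p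
  proof -
    obtain t where t: "t \<in> {a..b}"
      "\<bar>gromov_product (g a) (g b) (g t) - gromov_product (g a) (g b) p\<bar> \<le> L + c"
      using quasigeodesic_hits_projection[OF g(1,2)] by blast
    have "g a \<in> X" "g b \<in> X" "g t \<in> X" using g t by (auto simp: qi_embedding_def)
    from dist_le_via_projections[OF hyp this(1,2) g(3) this(3)] t M[OF g(1), of t]
    show ?thesis by (intro bexI[of _ t]) (auto simp: abs_le_iff)
  qed
  then show ?thesis using that by blast
qed

text \<open>
  The point of g whose position along g is that of w is close to the branching point of the tree
  spanned by w and the two ends of g.
\<close>

lemma quasigeodesic_contains_center:
  fixes X :: "'a::metric_space set"
  assumes hyp: "delta_hyperbolic \<delta> X" and L: "L \<ge> 1" "c \<ge> 0"
  obtains C where "\<And>(g :: real \<Rightarrow> 'a) a b w. qi_embedding L c {a..b} X g \<Longrightarrow> a \<le> b \<Longrightarrow> w \<in> X \<Longrightarrow>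
    \<exists>t\<in>{a..b}. gromov_product (g t) (g a) (g b) \<le> C \<and> gromov_product (g t) w (g a) \<le> C \<and>
      gromov_product (g t) w (g b) \<le> C"
proof -
  obtain M where M: "\<And>(g :: real \<Rightarrow> 'a) s t u. qi_embedding L c {s..u} X g \<Longrightarrow> s \<le> t \<Longrightarrow> t \<le> u \<Longrightarrow>
      gromov_product (g t) (g s) (g u) \<le> M"
    using quasigeodesic_gromov_product_bounded[OF hyp L] by metis
  define C where "C = M + (L + c) + \<delta>"
  have "\<exists>t\<in>{a..b}. gromov_product (g t) (g a) (g b) \<le> C \<and> gromov_product (g t) w (g a) \<le> C \<and>
      gromov_product (g t) w (g b) \<le> C"
    if g: "qi_embedding L c {a..b} X g" "a \<le> b" "w \<in> X" for g :: "real \<Rightarrow> 'a" and a b w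
  proof -
    obtain t where t: "t \<in> {a..b}"
      "\<bar>gromov_product (g a) (g b) (g t) - gromov_product (g a) (g b) w\<bar> \<le> L + c"
      using quasigeodesic_hits_projection[OF g(1,2)] by blast
    have X: "g a \<in> X" "g b \<in> X" "g t \<in> X" using g t by (auto simp: qi_embedding_def)
    have Mt: "gromov_product (g t) (g a) (g b) \<le> M" using M[OF g(1), of t] t by simp
    have d: "dist w (g t) \<le> gromov_product w (g a) (g b) + gromov_product (g t) (g a) (g b)
        + (L + c) + 2 * \<delta>"
      using dist_le_via_projections[OF hyp X(1,2) g(3) X(3)] t(2) by linarith
    have "gromov_product (g t) w (g a) \<le> C" "gromov_product (g t) w (g b) \<le> C"
      unfolding C_def gromov_product_def[of "g t" w]
      using d Mt t(2) dist_eq_projection_plus_height[where x = "g a" and y = "g b" and z = w]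
        dist_eq_projection_plus_height[where x = "g a" and y = "g b" and z = "g t"]
        dist_commute[of w "g a"] dist_commute[of w "g b"]
      by (simp_all add: abs_le_iff field_simps)
    moreover have "M \<le> C" using L delta_hyperbolic_nonneg[OF hyp] by (simp add: C_def)
    ultimately show ?thesis using t(1) Mt by (intro bexI[of _ t]) auto
  qed
  then show ?thesis using that by blast
qed

section \<open>Hyperbolicity of quasiruled spaces\<close>

text \<open>
  A quasi-isometric embedding changes distances by a factor and thus need not preserve Gromov
  products up to a constant. A bound on them can still be pulled back from X to Y, because closeness
  to a quasigeodesic links the two: a bounded product implies it in X by hyperbolicity, \<open>\<psi>\<close> reflects
  it, and it implies a bounded product in Y by the quasiruler property.
\<close>

lemma quasiruled_gromov_product_transfer:
  fixes X :: "'a::metric_space set" and Y :: "'b::metric_space set" and \<psi> :: "'b \<Rightarrow> 'a"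
  assumes hyp: "delta_hyperbolic \<delta> X" and \<psi>: "qi_embedding L' c' Y X \<psi>"
    and L: "L \<ge> 1" "c \<ge> 0" and qg: "quasigeodesic_space L c Y"
    and ruler: "\<And>I g. quasigeodesic L c Y I g \<Longrightarrow> quasiruler \<tau> Y I g"
  obtains C' where "\<And>p y z. p \<in> Y \<Longrightarrow> y \<in> Y \<Longrightarrow> z \<in> Y \<Longrightarrow>
    gromov_product (\<psi> p) (\<psi> y) (\<psi> z) \<le> C \<Longrightarrow> gromov_product p y z \<le> C'"
proof -
  have L': "L' \<ge> 1" "c' \<ge> 0" using \<psi> by (auto simp: qi_embedding_def)
  have LL': "L * L' \<ge> 1" "L' * c + c' \<ge> 0" using L L' mult_mono[of 1 L 1 L'] by auto
  obtain K where K: "\<And>(g :: real \<Rightarrow> 'a) a b p. qi_embedding (L * L') (L' * c + c') {a..b} X g \<Longrightarrow> a \<le> b \<Longrightarrow>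
      p \<in> X \<Longrightarrow> \<exists>t\<in>{a..b}. dist p (g t) \<le> gromov_product p (g a) (g b) + K"
    using quasigeodesic_passes_near[OF hyp LL'] by metis
  define C' where "C' = max \<tau> 0 + L' * (C + K + c')"
  have "gromov_product p y z \<le> C'"
    if p: "p \<in> Y" "y \<in> Y" "z \<in> Y" and small: "gromov_product (\<psi> p) (\<psi> y) (\<psi> z) \<le> C" for p y z
  proof -
    obtain a b g where ab: "a \<le> b" and g: "quasigeodesic L c Y {a..b} g" "g a = y" "g b = z"
      using qg p unfolding quasigeodesic_space_def by metis
    have gY: "qi_embedding L c {a..b} Y g" using g by (simp add: quasigeodesic_def)
    have "\<psi> p \<in> X" using \<psi> p by (auto simp: qi_embedding_def)
    from K[OF qi_embedding_compose[OF gY \<psi>] ab this] g small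
    obtain t where t: "t \<in> {a..b}" "dist (\<psi> p) (\<psi> (g t)) \<le> C + K" by auto
    have gt: "g t \<in> Y" using gY t by (auto simp: qi_embedding_def)
    have "dist p (g t) \<le> L' * (dist (\<psi> p) (\<psi> (g t)) + c')"
      using qi_embedding_lower[OF \<psi> p(1) gt] .
    also have "\<dots> \<le> L' * (C + K + c')" using t L' by (intro mult_left_mono) auto
    finally have near: "dist p (g t) \<le> L' * (C + K + c')" .
    have "gromov_product (g t) y z \<le> max \<tau> 0"
    proof (cases "t = a \<or> t = b")
      case True
      then show ?thesis using g by auto
    next
      case False
      then have "a < t" "t < b" using t by auto
      then have "dist (g a) (g t) + dist (g t) (g b) - dist (g a) (g b) \<le> 2 * \<tau>"
        using ruler[OF g(1)] t(1) ab unfolding quasiruler_def by auto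
      then show ?thesis using g by (simp add: gromov_product_def dist_commute)
    qed
    then show ?thesis
      using gromov_product_change_base[of p y z "g t"] near by (simp add: C'_def)
  qed
  then show ?thesis using that by blast
qed

text \<open>
  The Gromov product (y|z)_w in Y is compared with d(w, q) for a centre q of w, y, z that lies on a
  quasigeodesic of Y; the four-point condition is applied in X at the base point \<open>\<psi> q\<close>, where it turns
  one bounded Gromov product into another bounded one.
\<close>

theorem quasiruled_imp_hyperbolic:
  fixes X :: "'a::metric_space set" and Y :: "'b::metric_space set" and \<psi> :: "'b \<Rightarrow> 'a"
  assumes "hyperbolic X" and \<psi>: "qi_embedding L' c' Y X \<psi>" and "quasiruled Y"
  shows "hyperbolic Y"
proof -
  obtain \<delta> where hyp: "delta_hyperbolic \<delta> X"
    using assms(1) by (auto simp: hyperbolic_iff_delta_hyperbolic)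
  obtain L c \<tau> where L: "L \<ge> 1" "c \<ge> 0" and qg: "quasigeodesic_space L c Y"
    and ruler: "\<And>I g. quasigeodesic L c Y I g \<Longrightarrow> quasiruler \<tau> Y I g"
    using assms(3) unfolding quasiruled_def by blast
  have L': "L' \<ge> 1" "c' \<ge> 0" using \<psi> by (auto simp: qi_embedding_def)
  have \<psi>X: "\<psi> y \<in> X" if "y \<in> Y" for y using \<psi> that by (auto simp: qi_embedding_def)
  have LL': "L * L' \<ge> 1" "L' * c + c' \<ge> 0" using L L' mult_mono[of 1 L 1 L'] by auto
  obtain C where C: "\<And>(g :: real \<Rightarrow> 'a) a b w. qi_embedding (L * L') (L' * c + c') {a..b} X g \<Longrightarrow> a \<le> b \<Longrightarrow>
      w \<in> X \<Longrightarrow> \<exists>t\<in>{a..b}. gromov_product (g t) (g a) (g b) \<le> C \<and>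
        gromov_product (g t) w (g a) \<le> C \<and> gromov_product (g t) w (g b) \<le> C"
    using quasigeodesic_contains_center[OF hyp LL'] by metis
  obtain C' where C': "\<And>p y z. p \<in> Y \<Longrightarrow> y \<in> Y \<Longrightarrow> z \<in> Y \<Longrightarrow>
      gromov_product (\<psi> p) (\<psi> y) (\<psi> z) \<le> C + \<delta> \<Longrightarrow> gromov_product p y z \<le> C'"
    using quasiruled_gromov_product_transfer[OF hyp \<psi> L qg ruler] by metis
  have "gromov_product w y z
      \<ge> min (gromov_product w x y) (gromov_product w x z) - max 0 (3 * C')"
    if Y: "w \<in> Y" "x \<in> Y" "y \<in> Y" "z \<in> Y" for w x y z
  proof -
    obtain a b g where ab: "a \<le> b" and g: "quasigeodesic L c Y {a..b} g" "g a = y" "g b = z"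
      using qg Y unfolding quasigeodesic_space_def by metis
    have gY: "qi_embedding L c {a..b} Y g" using g by (simp add: quasigeodesic_def)
    from C[OF qi_embedding_compose[OF gY \<psi>] ab \<psi>X[OF Y(1)]] g
    obtain t where t: "t \<in> {a..b}" "gromov_product (\<psi> (g t)) (\<psi> y) (\<psi> z) \<le> C"
      "gromov_product (\<psi> (g t)) (\<psi> w) (\<psi> y) \<le> C" "gromov_product (\<psi> (g t)) (\<psi> w) (\<psi> z) \<le> C"
      by auto
    define q where "q = g t"
    have q: "q \<in> Y" using gY t by (auto simp: qi_embedding_def q_def)
    have \<delta>: "\<delta> \<ge> 0" using hyp by (rule delta_hyperbolic_nonneg)
    have wy: "gromov_product q w y \<le> C'" and wz: "gromov_product q w z \<le> C'"
      using C'[OF q Y(1) Y(3)] C'[OF q Y(1) Y(4)] t \<delta> by (auto simp: q_def)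
    have "min (gromov_product (\<psi> q) (\<psi> x) (\<psi> y)) (gromov_product (\<psi> q) (\<psi> x) (\<psi> z)) - \<delta>
        \<le> gromov_product (\<psi> q) (\<psi> y) (\<psi> z)"
      using hyp \<psi>X q Y unfolding delta_hyperbolic_def by blast
    then have "gromov_product (\<psi> q) (\<psi> x) (\<psi> y) \<le> C + \<delta> \<or> gromov_product (\<psi> q) (\<psi> x) (\<psi> z) \<le> C + \<delta>"
      using t(2) by (auto simp: q_def min_def split: if_splits)
    then have "gromov_product q x y \<le> C' \<or> gromov_product q x z \<le> C'"
      using C'[OF q Y(2) Y(3)] C'[OF q Y(2) Y(4)] by blast
    then have "min (gromov_product w x y) (gromov_product w x z) \<le> dist w q + C'"
      using gromov_product_change_base[of w x y q] gromov_product_change_base[of w x z q]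
      by (auto simp: min_def)
    moreover have "dist w q - 2 * C' \<le> gromov_product w y z"
      using wy wz dist_triangle[of y z q] by (simp add: gromov_product_def dist_commute field_simps)
    ultimately show ?thesis by linarith
  qed
  then show ?thesis unfolding hyperbolic_def by (intro exI[of _ "max 0 (3 * C')"]) simp
qed

theorem theorem1p10:
  fixes X :: "'a::metric_space set" and Y :: "'b::metric_space set" and \<phi> :: "'a \<Rightarrow> 'b"
  assumes "geodesic_space X" and "hyperbolic X" and "quasi_isometry X Y \<phi>"
  shows "hyperbolic Y \<longleftrightarrow> quasiruled Y"
proof
  assume Y: "hyperbolic Y"
  obtain L c where L: "L \<ge> 1" "c \<ge> 0" "quasigeodesic_space L c Y"
    using quasi_isometric_to_geodesic_imp_quasigeodesic_space[OF assms(1,3)] by blast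
  obtain \<tau> where "\<And>I g. quasigeodesic L c Y I g \<Longrightarrow> quasiruler \<tau> Y I g"
    using hyperbolic_quasigeodesic_is_quasiruler[OF Y L(1,2)] by blast
  then show "quasiruled Y" using L unfolding quasiruled_def by blast
next
  assume "quasiruled Y"
  obtain \<psi> L c where "qi_embedding L c Y X \<psi>"
    using quasi_isometry_quasi_inverse[OF assms(3)] by blast
  then show "hyperbolic Y" using quasiruled_imp_hyperbolic[OF assms(2)] \<open>quasiruled Y\<close> by blast
qed

end
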